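(* Let $1<\alpha<2$, let $a,b\in\mathbb{R}$ be such that $b-a$ is an integer with $b-a\ge 2$, and let $q:\mathbb{N}^{b}_{a+2}\to\mathbb{R}$ satisfy $$\sum_{s=a+2}^{b}|q(s)|<\frac{\Gamma(\alpha)}{(b-a-1)^{\overline{\alpha-1}}}.$$ Then the discrete fractional boundary value problem $$\begin{cases}(\nabla^{\alpha}_{a}u)(t)+q(t)u(t)=0,\quad t\in\mathbb{N}^{b}_{a+2},\\ u(a+1)=0,\quad (\nabla^{\alpha-1}_{a}u)(b)=0,\end{cases}$$ has no nontrivial solution on $\mathbb{N}^{b}_{a+1}$, i.e. its only solution $u:\mathbb{N}^{b}_{a+1}\to\mathbb{R}$ is $u\equiv0$.
   Context: For $a,b\in\mathbb{R}$ with $b-a\in\mathbb{Z}$: $\mathbb{N}_a=\{a,a+1,a+2,\dots\}$ and $\mathbb{N}_a^b=\{a,a+1,\dots,b\}$ (empty if $b<a$). Empty sums are $0$. The generalized rising function is $t^{\overline{r}}=\Gamma(t+r)/\Gamma(t)$ for $t,t+r\in\mathbb{R}\setminus\{0,-1,-2,\dots\}$, and $0^{\overline r}:=0$. The nabla difference is $(\nabla u)(t)=u(t)-u(t-1)$, and $\nabla^N$ is its $N$-fold iterate. For $\nu>0$ the nabla fractional sum based at $a$ is $(\nabla_a^{-\nu}u)(t)=\frac{1}{\Gamma(\nu)}\sum_{s=a+1}^{t}(t-s+1)^{\overline{\nu-1}}u(s)$ (so $(\nabla_a^{-\nu}u)(a)=0$ as an empty sum), and $\nabla_a^{-0}u=u$.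 For $\nu>0$ and a positive integer $N$ with $N-1<\nu\le N$, the Riemann-Liouville nabla fractional difference is $(\nabla_a^{\nu}u)(t)=\big(\nabla^N(\nabla_a^{-(N-\nu)}u)\big)(t)$, $t\in\mathbb{N}_{a+N}$. These values at $t$ depend only on $u(a+1),\dots,u(t)$, so they make sense for $u$ defined on $\mathbb{N}_{a+1}^b$ and $t\le b$. *)

theory Defs
  imports "HOL-Analysis.Analysis"
begin

definition nat_from_to :: "real \<Rightarrow> real \<Rightarrow> real set" where
  "nat_from_to a b = {x. (\<exists>k::nat. x = a + real k) \<and> x \<le> b}"

text \<open>The value at \<open>t = 0\<close> is a convention, not a value of the quotient. The quotient has its
  mathematical meaning only when neither \<open>t\<close> nor \<open>t + r\<close> is a pole of the Gamma function.\<close>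

definition rising :: "real \<Rightarrow> real \<Rightarrow> real" where
  "rising t r = (if t = 0 then 0 else Gamma (t + r) / Gamma t)"

definition nabla :: "(real \<Rightarrow> real) \<Rightarrow> real \<Rightarrow> real" where
  "nabla u t = u t - u (t - 1)"

text \<open>The fractional sum of order \<open>\<nu> \<ge> 0\<close> based at \<open>a\<close>, usually written with
  the superscript \<open>-\<nu>\<close>.\<close>

definition nabla_sum :: "real \<Rightarrow> real \<Rightarrow> (real \<Rightarrow> real) \<Rightarrow> real \<Rightarrow> real" where
  "nabla_sum a \<nu> u t =
     (if \<nu> = 0 then u t
      else 1 / Gamma \<nu> * (\<Sum>s\<in>nat_from_to (a + 1) t. rising (t - s + 1) (\<nu> - 1) * u s))"

text \<open>The Riemann--Liouville difference of order \<open>\<nu> > 0\<close>; for such \<open>\<nu>\<close>, the number \<open>N = nat \<lceil>\<nu>\<rceil>\<close>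
  is the positive integer with \<open>N - 1 < \<nu> \<le> N\<close>. It is meant for \<open>t = a + N, a + N + 1, \<dots>\<close>.\<close>

definition nabla_diff :: "real \<Rightarrow> real \<Rightarrow> (real \<Rightarrow> real) \<Rightarrow> real \<Rightarrow> real" where
  "nabla_diff a \<nu> u =
     (let N = nat \<lceil>\<nu>\<rceil> in (nabla ^^ N) (nabla_sum a (real N - \<nu>) u))"

text \<open>A function on \<open>nat_from_to (a + 1) b\<close> is represented by any \<open>u :: real \<Rightarrow> real\<close> extending it;
  for \<open>1 < \<alpha> < 2\<close> only the values of \<open>u\<close> on that set and of \<open>q\<close> on \<open>nat_from_to (a + 2) b\<close> matter.\<close>

definition bvp_solution ::
    "real \<Rightarrow> real \<Rightarrow> real \<Rightarrow> (real \<Rightarrow> real) \<Rightarrow> (real \<Rightarrow> real) \<Rightarrow> bool" where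
  "bvp_solution \<alpha> a b q u \<longleftrightarrow>
     (\<forall>t\<in>nat_from_to (a + 2) b. nabla_diff a \<alpha> u t + q t * u t = 0) \<and>
     u (a + 1) = 0 \<and> nabla_diff a (\<alpha> - 1) u b = 0"

end

(* Since u(a + 1) = 0, the equations can be solved forward in t: if u vanishes before t, then
   the fractional difference of u at t is u(t), so u(t) (1 + q(t)) = 0. The bound on the sum is
   at most 1, because (b - a - 1) rising (alpha - 1) is at least Gamma(alpha); hence |q(t)| < 1
   and u(t) = 0. *)
theory Submission
  imports Defs
begin

lemma finite_nat_from_to [simp]: "finite (nat_from_to a b)"
proof (rule finite_subset)
  show "nat_from_to a b \<subseteq> (\<lambda>k. a + real k) ` {..nat \<lfloor>b - a\<rfloor>}"
    unfolding nat_from_to_def by (auto intro!: image_eqI simp: le_nat_iff le_floor_iff)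
qed simp

lemma nabla_sum_eq_0:
  assumes "\<nu> \<noteq> 0" and "\<forall>s\<in>nat_from_to (a + 1) t. u s = 0"
  shows "nabla_sum a \<nu> u t = 0"
  using assms by (simp add: nabla_sum_def)

text \<open>Only the summand \<open>s = t\<close> survives, and its weight
  \<open>rising 1 (\<nu> - 1)\<close> is \<open>Gamma \<nu>\<close> because
  \<open>Gamma 1 = 1\<close>; this cancels the prefactor \<open>1 / Gamma \<nu>\<close>.\<close>

lemma nabla_sum_eq_last:
  assumes "0 < \<nu>" and t: "t \<in> nat_from_to (a + 1) t"
    and zero: "\<forall>s\<in>nat_from_to (a + 1) (t - 1). u s = 0"
  shows "nabla_sum a \<nu> u t = u t"
proof -
  have "s \<in> nat_from_to (a + 1) (t - 1)" if "s \<in> nat_from_to (a + 1) t - {t}" for s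
    using that t by (auto simp: nat_from_to_def)
  then have "(\<Sum>s\<in>nat_from_to (a + 1) t. rising (t - s + 1) (\<nu> - 1) * u s)
      = (\<Sum>s\<in>{t}. rising (t - s + 1) (\<nu> - 1) * u s)"
    using t zero by (intro sum.mono_neutral_right) auto
  also have "\<dots> = Gamma \<nu> * u t"
    by (simp add: rising_def)
  finally have "(\<Sum>s\<in>nat_from_to (a + 1) t. rising (t - s + 1) (\<nu> - 1) * u s) = Gamma \<nu> * u t" .
  moreover have "Gamma \<nu> \<noteq> 0"
    by (rule less_imp_neq[OF Gamma_real_pos[OF assms(1)], symmetric])
  ultimately show ?thesis
    using assms(1) by (simp add: nabla_sum_def)
qed

lemma nabla_diff_order_1_2:
  assumes "1 < \<alpha>" and "\<alpha> < 2"
  shows "nabla_diff a \<alpha> u t = nabla_sum a (2 - \<alpha>) u t - 2 * nabla_sum a (2 - \<alpha>) u (t - 1)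
      + nabla_sum a (2 - \<alpha>) u (t - 2)"
proof -
  have "\<lceil>\<alpha>\<rceil> = 2"
    using assms by linarith
  then show ?thesis
    by (simp add: nabla_diff_def nabla_def numeral_2_eq_2)
qed

lemma nabla_diff_order_0_1:
  assumes "0 < \<alpha>" and "\<alpha> < 1"
  shows "nabla_diff a \<alpha> u t = nabla_sum a (1 - \<alpha>) u t - nabla_sum a (1 - \<alpha>) u (t - 1)"
proof -
  have "\<lceil>\<alpha>\<rceil> = 1"
    using assms by linarith
  then show ?thesis
    by (simp add: nabla_diff_def nabla_def)
qed

text \<open>Equality holds at argument 1, and the quotient of consecutive values is at least 1 by
  the functional equation of Gamma. This turns the hypothesis on \<open>q\<close> into a bound by
  1.\<close>

lemma Gamma_le_rising:
  assumes "0 \<le> r"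
  shows "Gamma (r + 1) \<le> rising (real (Suc m)) r"
proof (induction m)
  case 0
  then show ?case
    by (simp add: rising_def add.commute)
next
  case (Suc m)
  have "rising (real (Suc (Suc m))) r = (real (Suc m) + r) / real (Suc m) * rising (real (Suc m)) r"
    using assms Gamma_plus1[of "real (Suc m) + r"] Gamma_plus1[of "real (Suc m)"]
    by (simp add: rising_def add_ac nonpos_Ints_def)
  moreover have "1 \<le> (real (Suc m) + r) / real (Suc m)"
    using assms by simp
  moreover have "0 < Gamma (r + 1)"
    using assms by (intro Gamma_real_pos) simp
  ultimately show ?case
    using Suc.IH mult_mono[of 1 "(real (Suc m) + r) / real (Suc m)" "Gamma (r + 1)" "rising (real (Suc m)) r"]
    by simp
qed

theorem theorem4p6:
  fixes \<alpha> a b :: real and q :: "real \<Rightarrow> real"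
  assumes "1 < \<alpha>" and "\<alpha> < 2"
    and "b - a \<in> \<int>" and "b - a \<ge> 2"
    and "(\<Sum>s\<in>nat_from_to (a + 2) b. \<bar>q s\<bar>) < Gamma \<alpha> / rising (b - a - 1) (\<alpha> - 1)"
  shows "\<forall>u :: real \<Rightarrow> real.
    bvp_solution \<alpha> a b q u \<longleftrightarrow> (\<forall>t\<in>nat_from_to (a + 1) b. u t = 0)"
proof (intro allI iffI)
  fix u :: "real \<Rightarrow> real"
  assume sol: "bvp_solution \<alpha> a b q u"
  obtain k :: int where k: "b - a = of_int k"
    using assms(3) by (auto elim: Ints_cases)
  \<comment> \<open>Since \<open>b - a \<ge> 2\<close>, the argument is a positive integer, the form
    that \<open>Gamma_le_rising\<close> requires.\<close>
  then have "b - a - 1 = real (Suc (nat (k - 2)))"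
    using assms(4) by simp
  then have "Gamma \<alpha> \<le> rising (b - a - 1) (\<alpha> - 1)"
    using Gamma_le_rising[of "\<alpha> - 1" "nat (k - 2)"] assms(1) by simp
  moreover have "0 < Gamma \<alpha>"
    using assms(1) by (intro Gamma_real_pos) simp
  ultimately have "Gamma \<alpha> / rising (b - a - 1) (\<alpha> - 1) \<le> 1"
    by (simp add: divide_le_eq_1)
  then have sum_less: "(\<Sum>s\<in>nat_from_to (a + 2) b. \<bar>q s\<bar>) < 1"
    using assms(5) by linarith
  have q_less: "\<bar>q t\<bar> < 1" if "t \<in> nat_from_to (a + 2) b" for t
    using member_le_sum[of t "nat_from_to (a + 2) b" "\<lambda>s. \<bar>q s\<bar>"] that sum_less by simp
  \<comment> \<open>The induction is strong because the fractional sum at a point involves all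
    earlier values of \<open>u\<close>.\<close>
  have u_zero: "u (a + 1 + real n) = 0" if "a + 1 + real n \<le> b" for n
    using that
  proof (induction n rule: less_induct)
    case (less n)
    show ?case
    proof (cases n)
      case 0
      then show ?thesis
        using sol by (simp add: bvp_solution_def)
    next
      case (Suc m)
      define t where "t = a + 1 + real n"
      \<comment> \<open>With \<open>n = Suc m\<close>, \<open>t\<close> is
        \<open>a + 2 + real m\<close>, so the difference equation is available at
        \<open>t\<close>.\<close>
      have t: "t \<in> nat_from_to (a + 2) b" "t \<in> nat_from_to (a + 1) t"
        using less.prems Suc by (auto simp: nat_from_to_def t_def intro: exI[of _ m] exI[of _ n])
      have prev: "\<forall>s\<in>nat_from_to (a + 1) (t - 1). u s = 0"
        using less by (auto simp: nat_from_to_def t_def)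
      then have "\<forall>s\<in>nat_from_to (a + 1) (t - 2). u s = 0"
        by (auto simp: nat_from_to_def)
      \<comment> \<open>Of the three fractional sums only the one at \<open>t\<close> is left. For
        \<open>m = 0\<close> the one at \<open>t - 2 = a\<close> is an empty sum.\<close>
      with prev have "nabla_diff a \<alpha> u t = u t"
        using assms(1,2) t
        by (simp add: nabla_diff_order_1_2 nabla_sum_eq_last nabla_sum_eq_0)
      then have "u t * (1 + q t) = 0"
        using sol t by (auto simp: bvp_solution_def algebra_simps)
      then show ?thesis
        using q_less[OF t(1)] by (auto simp: t_def)
    qed
  qed
  then show "\<forall>t\<in>nat_from_to (a + 1) b. u t = 0"
    by (auto simp: nat_from_to_def)
next
  fix u :: "real \<Rightarrow> real"
  assume zero: "\<forall>t\<in>nat_from_to (a + 1) b. u t = 0"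
  \<comment> \<open>No lower bound on \<open>t\<close> is imposed: below \<open>a + 1\<close> the
    sum is empty, which covers the shifted arguments \<open>t - 1\<close> and
    \<open>t - 2\<close>.\<close>
  have sum_zero: "nabla_sum a (2 - \<alpha>) u t = 0" if "t \<le> b" for t
    using that zero assms(2) by (intro nabla_sum_eq_0) (auto simp: nat_from_to_def)
  have "nabla_diff a \<alpha> u t = 0 \<and> u t = 0" if t: "t \<in> nat_from_to (a + 2) b" for t
  proof -
    obtain n where "t = a + 2 + real n" "t \<le> b"
      using t unfolding nat_from_to_def by blast
    then have "t \<in> nat_from_to (a + 1) b"
      by (auto simp: nat_from_to_def intro!: exI[of _ "Suc n"])
    then show ?thesis
      using assms(1,2) zero \<open>t \<le> b\<close> by (simp add: nabla_diff_order_1_2 sum_zero)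
  qed
  moreover have "a + 1 \<in> nat_from_to (a + 1) b"
    using assms(4) by (auto simp: nat_from_to_def)
  \<comment> \<open>Here the inner order is \<open>1 - (\<alpha> - 1) = 2 - \<alpha>\<close>, so
    \<open>sum_zero\<close> applies to this boundary condition as well.\<close>
  moreover have "nabla_diff a (\<alpha> - 1) u b = 0"
    using assms(1,2) by (simp add: nabla_diff_order_0_1 sum_zero)
  ultimately show "bvp_solution \<alpha> a b q u"
    using zero by (simp add: bvp_solution_def)
qed

end
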